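(* Let $I$ be a non-empty set. The antipode $\mathcal S$ of the Connes–Kreimer Hopf algebra $(\langle\mathscr F_I\rangle,\odot,\Delta_\star)$ of $I$-decorated forests admits, for every $\zeta\in\mathscr F_I$, the representation $$\mathcal S\zeta=\sum_{S\in\operatorname{Splits}(\zeta)}\mathrm s_\zeta(S)\,S,$$ where $(\operatorname{Splits}(\zeta))_{\zeta\in\mathscr F_I}$ is the family of finite subsets of $\mathscr F_I$ recursively defined by $\operatorname{Splits}(\mathbf 1):=\{\mathbf 1\}$ and, for $\zeta\ne\mathbf 1$, $$\operatorname{Splits}(\zeta):=\{C S\mid \exists\, T\neq\zeta:\ S\in\operatorname{Splits}(T),\ (C,T)\in\operatorname{Cuts}(\zeta)\},$$ and $(\mathrm s_\zeta)_{\zeta\in\mathscr F_I}$ is the family of functions $\mathrm s_\zeta:\operatorname{Splits}(\zeta)\to\mathbb Z$ recursively defined by $\mathrm s_{\mathbf 1}(\mathbf 1):=1$, $$\mathrm s_{\lfloor\zeta\rfloor_i}(\bar S):=-\sum_{\substack{(C,T)\in\operatorname{Cuts}(\lfloor\zeta\rfloor_i),\ S\in\operatorname{Splits}(T):\\ T\ne\lfloor\zeta\rfloor_i,\ CS=\bar S}}\mathrm s_T(S)\,\mathrm c_{\lfloor\zeta\rfloor_i}(C,T),\qquad \mathrm s_{\zeta_1\zeta_2}(S):=\sum_{\substack{S_1\in\operatorname{Splits}(\zeta_1),\ S_2\in\operatorname{Splits}(\zeta_2):\\ S_1S_2=S}}\mathrm s_{\zeta_1}(S_1)\,\mathrm 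s_{\zeta_2}(S_2).$$
   Context: $\mathscr T_I$ is the set of (non-planar) rooted trees with nodes decorated by $I$, $\mathscr F_I$ is the free commutative monoid on $\mathscr T_I$ (forests), with product $\odot$ (also written as juxtaposition) and unit $\mathbf 1$ (empty forest). For $\zeta\in\mathscr F_I$ and $i\in I$, $\lfloor\zeta\rfloor_i\in\mathscr T_I$ is the tree obtained by grafting all trees of $\zeta$ onto a new root labelled $i$; every tree is uniquely of this form. $\langle\mathscr F_I\rangle$ is the real vector space with basis $\mathscr F_I$, $\odot$ is extended bilinearly, $\lfloor\cdot\rfloor_i$ linearly. $\Delta_\star$ is the linear map with $\Delta_\star\mathbf 1=\mathbf 1\otimes\mathbf 1$, $\Delta_\star\lfloor\zeta\rfloor_i=\lfloor\zeta\rfloor_i\otimes\mathbf 1+(\mathrm{id}\otimes\lfloor\cdot\rfloor_i)\Delta_\star\zeta$, and multiplicative: $\Delta_\star(\zeta_1\zeta_2)=\Delta_\star\zeta_1\,\Delta_\star\zeta_2$ with componentwise product on the tensor square. The antipode $\mathcal S$ is the linear map recursively given by $\mathcal S\mathbf 1=\mathbf 1$, $\mathcal S(\zeta_1\zeta_2)=\mathcal S\zeta_1\odot\mathcal S\zeta_2$, $\mathcal S\lfloor\zeta\rfloor_i=-m_\odot(\mathcal S\otimes\lfloor\cdot\rfloor_i)\Delta_\star\zeta$, where $m_\odot(a\otimes b)=a\odot b$ (it is the unique antipode of this Hopf algebra). $\operatorname{Cuts}(\zeta)$ is the finite subset of $\mathscr F_I\times\mathscr F_I$ recursively defined by $\operatorname{Cuts}(\mathbf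 1):=\{(\mathbf 1,\mathbf 1)\}$, $\operatorname{Cuts}(\lfloor\zeta\rfloor_i):=\{(C,\lfloor T\rfloor_i)\mid (C,T)\in\operatorname{Cuts}(\zeta)\}\cup\{(\lfloor\zeta\rfloor_i,\mathbf 1)\}$, $\operatorname{Cuts}(\zeta_1\zeta_2):=\{(C_1C_2,T_1T_2)\mid(C_1,T_1)\in\operatorname{Cuts}(\zeta_1),(C_2,T_2)\in\operatorname{Cuts}(\zeta_2)\}$. The functions $\mathrm c_\zeta:\operatorname{Cuts}(\zeta)\to\mathbb N$ are recursively defined by $\mathrm c_\tau(\tau,\mathbf 1):=1$ for $\tau\in\mathscr T_I\cup\{\mathbf 1\}$, $\mathrm c_{\lfloor\zeta\rfloor_i}(C,\lfloor T\rfloor_i):=\mathrm c_\zeta(C,T)$, and $\mathrm c_{\zeta_1\zeta_2}(C,T):=\sum \mathrm c_{\zeta_1}(C_1,T_1)\mathrm c_{\zeta_2}(C_2,T_2)$, the sum over all $(C_1,T_1)\in\operatorname{Cuts}(\zeta_1)$, $(C_2,T_2)\in\operatorname{Cuts}(\zeta_2)$ with $C_1C_2=C$, $T_1T_2=T$. (Forests $\zeta$ decompose uniquely, up to order, into trees, and the recursions are independent of the chosen factorization.) *)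

theory Defs
  imports
    Complex_Main
    "HOL-Library.Multiset"
    "HOL-Library.Product_Plus"
    "HOL-Library.Set_Algebras"
    "HOL-Library.Poly_Mapping"
begin

(* The decoration set is the type 'i, non-empty like every type. Multisets make the trees
   non-planar and turn forests into the free commutative monoid on trees, written additively:
   juxtaposition of forests is + and the empty forest is {#}. *)

datatype 'i tree = Node 'i "'i tree multiset"

type_synonym 'i forest = "'i tree multiset"

primrec tree_nodes :: "'i tree \<Rightarrow> nat" where
  "tree_nodes (Node i \<zeta>) = Suc (\<Sum>\<^sub># (image_mset tree_nodes \<zeta>))"

definition nodes :: "'i forest \<Rightarrow> nat" where
  "nodes \<zeta> = \<Sum>\<^sub># (image_mset tree_nodes \<zeta>)"

lemma nodes_simps [simp]:
  "nodes {#} = 0" "nodes (add_mset \<tau> \<zeta>) = tree_nodes \<tau> + nodes \<zeta>"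
  "nodes (\<zeta> + \<xi>) = nodes \<zeta> + nodes \<xi>"
  by (simp_all add: nodes_def)

lemma tree_nodes_Node: "tree_nodes (Node i \<zeta>) = Suc (nodes \<zeta>)"
  by (simp add: nodes_def)

declare tree_nodes.simps [simp del]
declare tree_nodes_Node [simp]

lemma tree_nodes_le: "\<tau> \<in># \<zeta> \<Longrightarrow> tree_nodes \<tau> \<le> nodes \<zeta>"
  by (induction \<zeta>) auto

lemma tree_nodes_pos: "tree_nodes \<tau> > 0"
  by (cases \<tau>) simp

lemma nodes_eq_0: "nodes \<zeta> = 0 \<longleftrightarrow> \<zeta> = {#}"
  by (cases \<zeta>) (simp_all add: tree_nodes_pos[THEN less_imp_neq, symmetric])

lemma forest_induct [case_names empty node join]:
  assumes e: "P {#}" and g: "\<And>i \<zeta>. P \<zeta> \<Longrightarrow> P {#Node i \<zeta>#}"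
    and j: "\<And>\<tau> \<zeta>. P {#\<tau>#} \<Longrightarrow> P \<zeta> \<Longrightarrow> P ({#\<tau>#} + \<zeta>)"
  shows "P \<zeta>"
proof -
  have *: "P \<xi>" if "\<And>\<tau>. \<tau> \<in># \<xi> \<Longrightarrow> P {#\<tau>#}" for \<xi>
    using that
  proof (induction \<xi>)
    case (add \<tau> \<xi>)
    have "P ({#\<tau>#} + \<xi>)"
      by (rule j) (use add in simp_all)
    thus ?case by simp
  qed (rule e)
  have "P {#\<tau>#}" for \<tau>
    by (induction \<tau>) (rule g, rule *, blast)
  thus ?thesis using * by blast
qed

(* Elements are finitely supported real functions on the basis. On forests, the convolution
   product of Poly_Mapping is the bilinear extension of juxtaposition. *)

type_synonym 'i forest_alg = "'i forest \<Rightarrow>\<^sub>0 real"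

(* The tensor square, with basis element (C, T) for C \<otimes> T; since + on pairs is componentwise,
   the convolution product is the componentwise product of tensors. *)
type_synonym 'i forest_tensor = "'i forest \<times> 'i forest \<Rightarrow>\<^sub>0 real"

instantiation poly_mapping :: (type, real_vector) real_vector
begin

lift_definition scaleR_poly_mapping :: "real \<Rightarrow> ('a \<Rightarrow>\<^sub>0 'b) \<Rightarrow> 'a \<Rightarrow>\<^sub>0 'b"
  is "\<lambda>r f x. r *\<^sub>R f x"
  by (rule finite_subset[rotated]) auto

instance
  by standard (transfer; auto simp: algebra_simps fun_eq_iff)+

end

lemma lookup_scaleR: "Poly_Mapping.lookup (r *\<^sub>R p) x = r *\<^sub>R Poly_Mapping.lookup p x"
  by transfer simp

abbreviation basis :: "'a \<Rightarrow> 'a \<Rightarrow>\<^sub>0 real" where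
  "basis x \<equiv> Poly_Mapping.single x 1"

definition lin_ext :: "('a \<Rightarrow> 'v::real_vector) \<Rightarrow> ('a \<Rightarrow>\<^sub>0 real) \<Rightarrow> 'v" where
  "lin_ext f p = (\<Sum>x\<in>Poly_Mapping.keys p. Poly_Mapping.lookup p x *\<^sub>R f x)"

lemma lin_ext_cong [fundef_cong]:
  "p = q \<Longrightarrow> (\<And>x. x \<in> Poly_Mapping.keys q \<Longrightarrow> f x = g x) \<Longrightarrow> lin_ext f p = lin_ext g q"
  by (simp add: lin_ext_def)

lemma lin_ext_superset:
  "finite A \<Longrightarrow> Poly_Mapping.keys p \<subseteq> A \<Longrightarrow>
    lin_ext f p = (\<Sum>x\<in>A. Poly_Mapping.lookup p x *\<^sub>R f x)"
  unfolding lin_ext_def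
  by (rule sum.mono_neutral_left) (auto simp: in_keys_iff)

lemma linear_lin_ext: "linear (lin_ext f)"
proof (rule linearI)
  fix p q :: "'a \<Rightarrow>\<^sub>0 real" and r :: real
  let ?A = "Poly_Mapping.keys p \<union> Poly_Mapping.keys q"
  have "lin_ext f (p + q) = (\<Sum>x\<in>?A. Poly_Mapping.lookup (p + q) x *\<^sub>R f x)"
    by (rule lin_ext_superset) (use keys_add[of p q] in auto)
  also have "\<dots> = (\<Sum>x\<in>?A. Poly_Mapping.lookup p x *\<^sub>R f x) + (\<Sum>x\<in>?A. Poly_Mapping.lookup q x *\<^sub>R f x)"
    by (simp add: lookup_add scaleR_left_distrib sum.distrib)
  also have "\<dots> = lin_ext f p + lin_ext f q"
    using lin_ext_superset[of ?A p f] lin_ext_superset[of ?A q f] by simp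
  finally show "lin_ext f (p + q) = lin_ext f p + lin_ext f q" .
  have "lin_ext f (r *\<^sub>R p) = (\<Sum>x\<in>Poly_Mapping.keys p. Poly_Mapping.lookup (r *\<^sub>R p) x *\<^sub>R f x)"
    by (rule lin_ext_superset) (auto simp: in_keys_iff lookup_scaleR)
  thus "lin_ext f (r *\<^sub>R p) = r *\<^sub>R lin_ext f p"
    by (simp add: lookup_scaleR lin_ext_def scaleR_sum_right)
qed

lemma lin_ext_basis [simp]: "lin_ext f (basis x) = f x"
  by (simp add: lin_ext_def)

lemma poly_expand:
  fixes p :: "'a \<Rightarrow>\<^sub>0 'b::comm_monoid_add"
  assumes "finite A" "Poly_Mapping.keys p \<subseteq> A"
  shows "p = (\<Sum>x\<in>A. Poly_Mapping.single x (Poly_Mapping.lookup p x))"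
proof (rule poly_mapping_eqI)
  fix k
  have "(\<Sum>x\<in>A. (Poly_Mapping.lookup p x when x = k)) = Poly_Mapping.lookup p k"
    using assms by (auto simp: when_def sum.delta' in_keys_iff)
  thus "Poly_Mapping.lookup p k =
      Poly_Mapping.lookup (\<Sum>x\<in>A. Poly_Mapping.single x (Poly_Mapping.lookup p x)) k"
    by (simp add: lookup_sum lookup_single)
qed

lemma linear_eq_on_basis:
  assumes "linear f" "linear g" "\<And>x. f (basis x) = g (basis x)"
  shows "f p = g p"
proof -
  let ?e = "\<Sum>x\<in>Poly_Mapping.keys p. Poly_Mapping.lookup p x *\<^sub>R basis x"
  have "Poly_Mapping.lookup p x *\<^sub>R basis x = Poly_Mapping.single x (Poly_Mapping.lookup p x)" for x
    by (rule poly_mapping_eqI) (simp add: lookup_scaleR lookup_single when_def)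
  hence e: "?e = p"
    using poly_expand[of "Poly_Mapping.keys p" p] by simp
  have "f ?e = g ?e"
    by (simp add: linear_sum[OF assms(1)] linear_sum[OF assms(2)]
        linear_scale[OF assms(1)] linear_scale[OF assms(2)] assms(3))
  thus ?thesis unfolding e .
qed

lemma linear_mult_right: "linear (\<lambda>q. p * (q :: 'a::comm_monoid_add \<Rightarrow>\<^sub>0 real))"
proof (rule linearI)
  fix r :: real and q :: "'a \<Rightarrow>\<^sub>0 real"
  have s: "r *\<^sub>R x = Poly_Mapping.single 0 r * x" for x :: "'a \<Rightarrow>\<^sub>0 real"
  proof (rule poly_mapping_eqI)
    fix k
    have "Poly_Mapping.lookup (Poly_Mapping.single 0 r * x) k = 
       Poly_Mapping.lookup (Poly_Mapping.single 0 r * (\<Sum>a\<in>Poly_Mapping.keys x. Poly_Mapping.single a (Poly_Mapping.lookup x a))) k"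
      using poly_expand[of "Poly_Mapping.keys x" x] by simp
    also have "\<dots> = (\<Sum>a\<in>Poly_Mapping.keys x. (r * Poly_Mapping.lookup x a when a = k))"
      by (simp add: sum_distrib_left mult_single lookup_sum lookup_single)
    also have "\<dots> = r * Poly_Mapping.lookup x k"
      by (auto simp: when_def in_keys_iff)
    finally show "Poly_Mapping.lookup (r *\<^sub>R x) k = Poly_Mapping.lookup (Poly_Mapping.single 0 r * x) k"
      by (simp add: lookup_scaleR)
  qed
  show "p * (r *\<^sub>R q) = r *\<^sub>R (p * q)"
    unfolding s by (simp add: algebra_simps)
qed (rule distrib_left)

lemma linear_mult_left: "linear (\<lambda>q. (q :: 'a::comm_monoid_add \<Rightarrow>\<^sub>0 real) * p)"
  unfolding mult.commute[of _ p] by (rule linear_mult_right)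

lemma lin_ext_mult:
  fixes f :: "'a::comm_monoid_add \<Rightarrow> ('b::comm_monoid_add \<Rightarrow>\<^sub>0 real)"
  assumes "\<And>x y. f (x + y) = f x * f y"
  shows "lin_ext f (p * q) = lin_ext f p * lin_ext f q"
proof -
  note L = linear_compose[unfolded o_def]
  show ?thesis
  proof (rule linear_eq_on_basis[where p = p])
    show "linear (\<lambda>p. lin_ext f (p * q))" "linear (\<lambda>p. lin_ext f p * lin_ext f q)"
      by (rule L[OF linear_mult_left linear_lin_ext] L[OF linear_lin_ext linear_mult_left])+
    fix x
    show "lin_ext f (basis x * q) = lin_ext f (basis x) * lin_ext f q"
    proof (rule linear_eq_on_basis[where p = q])
      show "linear (\<lambda>q. lin_ext f (basis x * q))" 
        "linear (\<lambda>q. lin_ext f (basis x) * lin_ext f q)"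
        by (rule L[OF linear_mult_right linear_lin_ext] L[OF linear_lin_ext linear_mult_right])+
    qed (simp add: mult_single assms)
  qed
qed

lemma lookup_mult_on:
  fixes p q :: "'a::comm_monoid_add \<Rightarrow>\<^sub>0 'b::comm_semiring_1"
  assumes "finite A" "Poly_Mapping.keys p \<subseteq> A" "finite B" "Poly_Mapping.keys q \<subseteq> B"
  shows "Poly_Mapping.lookup (p * q) k =
    (\<Sum>(a, b)\<in>{(a, b). a \<in> A \<and> b \<in> B \<and> a + b = k}. Poly_Mapping.lookup p a * Poly_Mapping.lookup q b)"
proof -
  have "p * q = (\<Sum>a\<in>A. \<Sum>b\<in>B. Poly_Mapping.single (a + b) (Poly_Mapping.lookup p a * Poly_Mapping.lookup q b))"
    by (subst poly_expand[OF assms(1,2)], subst poly_expand[OF assms(3,4)])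
       (simp add: sum_product mult_single)
  hence "Poly_Mapping.lookup (p * q) k =
    (\<Sum>(a, b)\<in>A \<times> B. (Poly_Mapping.lookup p a * Poly_Mapping.lookup q b when a + b = k))"
    by (simp add: lookup_sum lookup_single flip: sum.cartesian_product)
  also have "\<dots> = (\<Sum>(a, b)\<in>{(a, b). a \<in> A \<and> b \<in> B \<and> a + b = k}. Poly_Mapping.lookup p a * Poly_Mapping.lookup q b)"
  proof (rule sum.mono_neutral_cong_right)
    show "finite (A \<times> B)" using assms by simp
    show "\<forall>x\<in>A \<times> B - {(a, b). a \<in> A \<and> b \<in> B \<and> a + b = k}.
      (case x of (a, b) \<Rightarrow> (Poly_Mapping.lookup p a * Poly_Mapping.lookup q b when a + b = k)) = 0"
      by clarsimp
  qed (auto simp: when_def)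
  finally show ?thesis .
qed

(* Connes--Kreimer coproduct: the left factor collects the pruned branches, the right factor
   is the trunk that keeps the roots. tree_coproduct is the recursion on trees, with the factorization of a forest
   into its trees as a product over the multiset; coproduct_one, coproduct_mult and coproduct_graft
   recover the recursion for arbitrary factorizations. *)

definition graft :: "'i \<Rightarrow> 'i forest_alg \<Rightarrow> 'i forest_alg" where
  "graft i = lin_ext (\<lambda>\<zeta>. basis {#Node i \<zeta>#})"

definition tensor :: "'i forest_alg \<Rightarrow> 'i forest_alg \<Rightarrow> 'i forest_tensor" (infixr "\<otimes>" 70) where
  "p \<otimes> q = lin_ext (\<lambda>a. lin_ext (\<lambda>b. basis (a, b)) q) p"

definition tensor_map ::
  "('i forest_alg \<Rightarrow> 'i forest_alg) \<Rightarrow> ('i forest_alg \<Rightarrow> 'i forest_alg) \<Rightarrow>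
    'i forest_tensor \<Rightarrow> 'i forest_tensor" where
  "tensor_map f g = lin_ext (\<lambda>(a, b). f (basis a) \<otimes> g (basis b))"

definition tensor_mult :: "'i forest_tensor \<Rightarrow> 'i forest_alg" where
  "tensor_mult = lin_ext (\<lambda>(a, b). basis (a + b))"

primrec tree_coproduct :: "'i tree \<Rightarrow> 'i forest_tensor" where
  "tree_coproduct (Node i \<zeta>) = basis {#Node i \<zeta>#} \<otimes> 1
     + tensor_map id (graft i) (\<Prod>\<^sub># (image_mset tree_coproduct \<zeta>))"

definition coproduct :: "'i forest_alg \<Rightarrow> 'i forest_tensor" where
  "coproduct = lin_ext (\<lambda>\<zeta>. \<Prod>\<^sub># (image_mset tree_coproduct \<zeta>))"

lemma graft_basis [simp]: "graft i (basis \<zeta>) = basis {#Node i \<zeta>#}"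
  by (simp add: graft_def)

lemma one_basis: "(1 :: 'a::zero \<Rightarrow>\<^sub>0 real) = basis 0"
  by (simp add: single_one)

lemma tensor_basis [simp]: "basis a \<otimes> basis b = basis (a, b)"
  by (simp add: tensor_def)

lemma tensor_one [simp]: "basis a \<otimes> 1 = basis (a, {#})"
  unfolding one_basis by (rule tensor_basis)

lemma coproduct_basis: "coproduct (basis \<zeta>) = \<Prod>\<^sub># (image_mset tree_coproduct \<zeta>)"
  by (simp add: coproduct_def)

lemma linear_coproduct: "linear coproduct"
  unfolding coproduct_def by (rule linear_lin_ext)

lemma coproduct_one: "coproduct 1 = 1 \<otimes> 1"
  by (simp only: one_basis coproduct_basis tensor_basis) (simp add: zero_prod_def[symmetric])

lemma coproduct_mult: "coproduct (p * q) = coproduct p * coproduct q"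
  unfolding coproduct_def by (rule lin_ext_mult) simp

lemma coproduct_graft:
  "coproduct (graft i p) = graft i p \<otimes> 1 + tensor_map id (graft i) (coproduct p)"
proof (rule linear_eq_on_basis[where p = p])
  note L = linear_compose[unfolded o_def]
  have 1: "linear (graft i)" "linear (tensor_map id (graft i))" "linear (\<lambda>p. p \<otimes> 1)"
    unfolding graft_def tensor_map_def tensor_def by (rule linear_lin_ext)+
  show "linear (\<lambda>p. coproduct (graft i p))"
    by (rule L[OF 1(1) linear_coproduct])
  show "linear (\<lambda>p. graft i p \<otimes> 1 + tensor_map id (graft i) (coproduct p))"
    by (rule linear_compose_add L[OF 1(1) 1(3)] L[OF linear_coproduct 1(2)])+
qed (simp add: coproduct_basis id_def)

lemma keys_lin_ext:
  "Poly_Mapping.keys (lin_ext f p) \<subseteq> (\<Union>x\<in>Poly_Mapping.keys p. Poly_Mapping.keys (f x))"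
proof -
  have "Poly_Mapping.keys (r *\<^sub>R q) \<subseteq> Poly_Mapping.keys q" for r and q :: "'a \<Rightarrow>\<^sub>0 'b::real_vector"
    by (auto simp: in_keys_iff lookup_scaleR)
  thus ?thesis
    unfolding lin_ext_def by (intro order.trans[OF keys_sum]) blast
qed

lemma keys_coproduct_nodes:
  "(C, T) \<in> Poly_Mapping.keys (\<Prod>\<^sub># (image_mset tree_coproduct \<zeta>)) \<Longrightarrow> nodes C + nodes T = nodes \<zeta>"
proof (induction \<zeta> arbitrary: C T rule: forest_induct)
  case empty
  thus ?case by (simp add: zero_prod_def)
next
  case (node i \<zeta>)
  have "(C, T) = ({#Node i \<zeta>#}, {#}) \<or>
     (C, T) \<in> Poly_Mapping.keys (tensor_map id (graft i) (\<Prod>\<^sub># (image_mset tree_coproduct \<zeta>)))"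
    using node.prems keys_add[of "basis ({#Node i \<zeta>#}, {#})"
      "tensor_map id (graft i) (\<Prod>\<^sub># (image_mset tree_coproduct \<zeta>))"] by auto
  thus ?case
  proof
    assume A: "(C, T) \<in> Poly_Mapping.keys (tensor_map id (graft i) (\<Prod>\<^sub># (image_mset tree_coproduct \<zeta>)))"
    obtain T' where "(C, T') \<in> Poly_Mapping.keys (\<Prod>\<^sub># (image_mset tree_coproduct \<zeta>))" "T = {#Node i T'#}"
    proof -
      obtain a b where "(a, b) \<in> Poly_Mapping.keys (\<Prod>\<^sub># (image_mset tree_coproduct \<zeta>))"
        "(C, T) \<in> Poly_Mapping.keys (id (basis a) \<otimes> graft i (basis b))"
        using subsetD[OF keys_lin_ext A[unfolded tensor_map_def]] by fast
      thus ?thesis using that[of b] by simp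
    qed
    thus ?thesis using node.IH[of C T'] by simp
  qed auto
next
  case (join \<tau> \<zeta>)
  let ?K = "\<lambda>\<zeta>. Poly_Mapping.keys (\<Prod>\<^sub># (image_mset tree_coproduct \<zeta>))"
  have "(C, T) \<in> {a + b | a b. a \<in> ?K {#\<tau>#} \<and> b \<in> ?K \<zeta>}"
    using subsetD[OF keys_mult, of "(C, T)" "tree_coproduct \<tau>" "\<Prod>\<^sub># (image_mset tree_coproduct \<zeta>)"]
      join.prems by simp
  then obtain a b where ab: "(C, T) = a + b" "a \<in> ?K {#\<tau>#}" "b \<in> ?K \<zeta>"
    by blast
  show ?case
    using ab join.IH(1)[of "fst a" "snd a"] join.IH(2)[of "fst b" "snd b"]
    by (cases a, cases b) simp
qed

(* On basis elements m(S \<otimes> graft) sends C \<otimes> T to the product of S C and the tree with branches T;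
   antipode_graft below is the recursion in its coordinate-free form. *)
function tree_antipode :: "'i tree \<Rightarrow> 'i forest_alg" where
  "tree_antipode (Node i \<zeta>) =
     - lin_ext (\<lambda>p. \<Prod>\<^sub># (image_mset tree_antipode (fst p)) * basis {#Node i (snd p)#})
         (coproduct (basis \<zeta>))"
  by pat_completeness auto
termination
proof (relation "measure tree_nodes")
  fix i :: 'i and \<zeta> and p :: "'i forest \<times> 'i forest" and \<tau>
  assume "p \<in> Poly_Mapping.keys (coproduct (basis \<zeta>))" "\<tau> \<in># fst p"
  thus "(\<tau>, Node i \<zeta>) \<in> measure tree_nodes"
    using keys_coproduct_nodes[of "fst p" "snd p" \<zeta>] tree_nodes_le[of \<tau> "fst p"]
    by (simp add: coproduct_basis)
qed simp

definition antipode :: "'i forest_alg \<Rightarrow> 'i forest_alg" where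
  "antipode = lin_ext (\<lambda>\<zeta>. \<Prod>\<^sub># (image_mset tree_antipode \<zeta>))"

lemma linear_antipode: "linear antipode"
  unfolding antipode_def by (rule linear_lin_ext)

lemma antipode_basis: "antipode (basis \<zeta>) = \<Prod>\<^sub># (image_mset tree_antipode \<zeta>)"
  by (simp add: antipode_def)

lemma antipode_one: "antipode 1 = 1"
  by (simp only: one_basis antipode_basis) simp

lemma antipode_mult: "antipode (p * q) = antipode p * antipode q"
  unfolding antipode_def by (rule lin_ext_mult) simp

lemma linear_tensor_mult: "linear tensor_mult"
  unfolding tensor_mult_def by (rule linear_lin_ext)

lemma tensor_mult_tensor: "tensor_mult (p \<otimes> q) = p * q"
proof (rule linear_eq_on_basis[where p = p])
  note L = linear_compose[unfolded o_def]
  show "linear (\<lambda>p. tensor_mult (p \<otimes> q))"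
    by (rule L[OF _ linear_tensor_mult]) (simp add: tensor_def linear_lin_ext)
  show "linear (\<lambda>p. p * q)" by (rule linear_mult_left)
  fix a
  show "tensor_mult (basis a \<otimes> q) = basis a * q"
  proof (rule linear_eq_on_basis[where p = q])
    show "linear (\<lambda>q. tensor_mult (basis a \<otimes> q))"
      by (rule L[OF _ linear_tensor_mult]) (simp add: tensor_def linear_lin_ext)
    show "linear (\<lambda>q. basis a * q)" by (rule linear_mult_right)
  qed (simp add: tensor_mult_def mult_single)
qed

lemma antipode_graft:
  "antipode (graft i p) = - tensor_mult (tensor_map antipode (graft i) (coproduct p))"
proof (rule linear_eq_on_basis[where p = p])
  note L = linear_compose[unfolded o_def]
  have 1: "linear (graft i)" "linear (tensor_map antipode (graft i))"
    unfolding graft_def tensor_map_def by (rule linear_lin_ext)+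
  show "linear (\<lambda>p. antipode (graft i p))"
    by (rule L[OF 1(1) linear_antipode])
  show "linear (\<lambda>p. - tensor_mult (tensor_map antipode (graft i) (coproduct p)))"
    by (intro linear_compose_neg L[OF L[OF linear_coproduct 1(2)] linear_tensor_mult])
  fix \<zeta>
  have "lin_ext (\<lambda>p. \<Prod>\<^sub># (image_mset tree_antipode (fst p)) * basis {#Node i (snd p)#}) q =
     tensor_mult (tensor_map antipode (graft i) q)" for q
    by (rule linear_eq_on_basis[OF linear_lin_ext L[OF 1(2) linear_tensor_mult]])
       (auto simp: tensor_map_def tensor_mult_tensor antipode_basis)
  thus "antipode (graft i (basis \<zeta>)) = - tensor_mult (tensor_map antipode (graft i) (coproduct (basis \<zeta>)))"
    by (simp add: antipode_basis)
qed

(* The antipode is a left convolution inverse of the identity: the right-hand side is the unit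
   composed with the counit. *)
lemma antipode_convolution_id:
  fixes p :: "'i forest_alg"
  shows "tensor_mult (tensor_map antipode id (coproduct p)) = Poly_Mapping.single {#} (Poly_Mapping.lookup p {#})"
proof -
  note L = linear_compose[unfolded o_def]
  define L' where "L' = lin_ext (\<lambda>(a :: 'i forest, b). antipode (basis a) * basis b)"
  have tm: "linear (tensor_map f g)" for f g :: "'i forest_alg \<Rightarrow> 'i forest_alg"
    unfolding tensor_map_def by (rule linear_lin_ext)
  have lin: "linear L'"
    unfolding L'_def by (rule linear_lin_ext)
  have L': "tensor_mult (tensor_map antipode id q) = L' q" for q
  proof (rule linear_eq_on_basis[where p = q])
    show "linear (\<lambda>q :: 'i forest_tensor. tensor_mult (tensor_map antipode id q))"
      by (rule L[OF tm linear_tensor_mult])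
  qed (auto simp: lin, auto simp: L'_def tensor_map_def tensor_mult_tensor)
  have mult: "L' (q * r) = L' q * L' r" for q r
    unfolding L'_def
  proof (rule lin_ext_mult)
    fix x y :: "'i forest \<times> 'i forest"
    have "basis (a + b) = basis a * basis b" for a b :: "'i forest"
      by (simp add: mult_single)
    thus "(case x + y of (a, b) \<Rightarrow> antipode (basis a) * basis b) =
        (case x of (a, b) \<Rightarrow> antipode (basis a) * basis b) * (case y of (a, b) \<Rightarrow> antipode (basis a) * basis b)"
      by (cases x, cases y) (simp add: antipode_basis ac_simps)
  qed
  have L'_graft: "L' (tensor_map id (graft i) q) = tensor_mult (tensor_map antipode (graft i) q)" for i q
  proof (rule linear_eq_on_basis[where p = q])
    show "linear (\<lambda>q. L' (tensor_map id (graft i) q))"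
      by (rule L[OF tm lin])
    show "linear (\<lambda>q. tensor_mult (tensor_map antipode (graft i) q))"
      by (rule L[OF tm linear_tensor_mult])
  qed (auto simp: L'_def tensor_map_def tensor_mult_tensor)
  have tree: "L' (tree_coproduct \<tau>) = 0" for \<tau>
  proof (cases \<tau>)
    case (Node i \<zeta>)
    have "L' (tree_coproduct \<tau>) = L' (basis ({#Node i \<zeta>#}, {#})) + L' (tensor_map id (graft i) (coproduct (basis \<zeta>)))"
      by (simp add: Node L'_def coproduct_basis linear_add[OF linear_lin_ext])
    also have "L' (basis ({#Node i \<zeta>#}, {#})) = antipode (graft i (basis \<zeta>))"
      by (simp add: L'_def)
    finally show ?thesis 
      using L'_graft[of i "coproduct (basis \<zeta>)"] antipode_graft[of i "basis \<zeta>"] by (simp add: id_def)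
  qed
  have "L' (coproduct (basis \<zeta>)) = Poly_Mapping.single {#} (Poly_Mapping.lookup (basis \<zeta>) {#})" for \<zeta>
  proof (cases \<zeta>)
    case empty
    have "coproduct (basis \<zeta>) = basis ({#}, {#})"
      using coproduct_one unfolding empty one_basis tensor_basis .
    thus ?thesis by (simp add: empty L'_def antipode_one)
  next
    case (add \<tau> \<xi>)
    thus ?thesis by (simp add: coproduct_basis mult tree lookup_single)
  qed
  moreover have "linear (\<lambda>p. Poly_Mapping.single {#} (Poly_Mapping.lookup (p :: 'i forest_alg) {#}) :: 'i forest_alg)"
    by (rule linearI) (auto intro!: poly_mapping_eqI simp: lookup_add lookup_scaleR lookup_single when_def)
  ultimately show ?thesis
    unfolding L'
    using linear_eq_on_basis[OF L[OF linear_coproduct lin],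
        of "\<lambda>p. Poly_Mapping.single {#} (Poly_Mapping.lookup p {#})" p] by blast
qed

(* The sum over the trees of \<zeta> is in the monoid of sets of pairs under elementwise addition. *)

primrec tree_cuts :: "'i tree \<Rightarrow> ('i forest \<times> 'i forest) set" where
  "tree_cuts (Node i \<zeta>) =
     (\<lambda>(C, T). (C, {#Node i T#})) ` (\<Sum>\<^sub># (image_mset tree_cuts \<zeta>)) \<union> {({#Node i \<zeta>#}, {#})}"

definition Cuts :: "'i forest \<Rightarrow> ('i forest \<times> 'i forest) set" where
  "Cuts \<zeta> = \<Sum>\<^sub># (image_mset tree_cuts \<zeta>)"

lemma Cuts_empty: "Cuts {#} = {({#}, {#})}"
  by (simp add: Cuts_def set_zero zero_prod_def)

lemma Cuts_tree:
  "Cuts {#Node i \<zeta>#} = {(C, {#Node i T#}) | C T. (C, T) \<in> Cuts \<zeta>} \<union> {({#Node i \<zeta>#}, {#})}"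
  unfolding Cuts_def by auto

lemma Cuts_add:
  "Cuts (\<zeta>1 + \<zeta>2) = {(C1 + C2, T1 + T2) | C1 C2 T1 T2. (C1, T1) \<in> Cuts \<zeta>1 \<and> (C2, T2) \<in> Cuts \<zeta>2}"
proof -
  have "Cuts (\<zeta>1 + \<zeta>2) = Cuts \<zeta>1 + Cuts \<zeta>2"
    by (simp add: Cuts_def)
  thus ?thesis
    by (fastforce simp: set_plus_def)
qed

lemma finite_Cuts: "finite (Cuts \<zeta>)"
proof (induction \<zeta> rule: forest_induct)
  case (node i \<zeta>)
  thus ?case by (simp add: Cuts_def)
next
  case (join \<tau> \<zeta>)
  hence "finite (Cuts {#\<tau>#} + Cuts \<zeta>)" by (rule finite_set_plus)
  thus ?case by (simp add: Cuts_def)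
qed (simp add: Cuts_empty)

lemma Cuts_nodes: "(C, T) \<in> Cuts \<zeta> \<Longrightarrow> nodes C + nodes T = nodes \<zeta>"
proof (induction \<zeta> arbitrary: C T rule: forest_induct)
  case (node i \<zeta>)
  thus ?case by (fastforce simp: Cuts_tree)
next
  case (join \<tau> \<zeta>)
  obtain C1 C2 T1 T2 where *: "C = C1 + C2" "T = T1 + T2" "(C1, T1) \<in> Cuts {#\<tau>#}" "(C2, T2) \<in> Cuts \<zeta>"
    using join.prems unfolding Cuts_add by blast
  show ?case using join.IH(1)[OF *(3)] join.IH(2)[OF *(4)] * by simp
qed (simp add: Cuts_empty)

lemma Cuts_trivial: "(C, T) \<in> Cuts \<zeta> \<Longrightarrow> C = {#} \<longleftrightarrow> T = \<zeta>"
proof (induction \<zeta> arbitrary: C T rule: forest_induct)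
  case (node i \<zeta>)
  thus ?case by (auto simp: Cuts_tree)
next
  case (join \<tau> \<zeta>)
  obtain C1 C2 T1 T2 where *: "C = C1 + C2" "T = T1 + T2" "(C1, T1) \<in> Cuts {#\<tau>#}" "(C2, T2) \<in> Cuts \<zeta>"
    using join.prems unfolding Cuts_add by blast
  show ?case
  proof
    assume "C = {#}"
    thus "T = {#\<tau>#} + \<zeta>" using * join.IH by auto
  next
    assume "T = {#\<tau>#} + \<zeta>"
    hence "nodes C = 0"
      using Cuts_nodes[OF join.prems] by simp
    thus "C = {#}" by (simp add: nodes_eq_0)
  qed
qed (simp add: Cuts_empty)

lemma Cuts_nodes_less: "(C, T) \<in> Cuts \<zeta> \<Longrightarrow> T \<noteq> \<zeta> \<Longrightarrow> nodes T < nodes \<zeta>"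
  using Cuts_nodes[of C T \<zeta>] Cuts_trivial[of C T \<zeta>] nodes_eq_0[of C] by linarith

(* The defining recursion of the multiplicities c_\<zeta>, extended by zero outside Cuts(\<zeta>);
   ex1_cut_mult shows that it has exactly one solution, i.e. does not depend on factorizations. *)
definition is_cut_mult :: "('i forest \<Rightarrow> 'i forest \<times> 'i forest \<Rightarrow> nat) \<Rightarrow> bool" where
  "is_cut_mult c \<longleftrightarrow>
     (\<forall>\<zeta> p. p \<notin> Cuts \<zeta> \<longrightarrow> c \<zeta> p = 0) \<and>
     c {#} ({#}, {#}) = 1 \<and>
     (\<forall>\<tau>. c {#\<tau>#} ({#\<tau>#}, {#}) = 1) \<and>
     (\<forall>i \<zeta> C T. (C, T) \<in> Cuts \<zeta> \<longrightarrow> c {#Node i \<zeta>#} (C, {#Node i T#}) = c \<zeta> (C, T)) \<and>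
     (\<forall>\<zeta>1 \<zeta>2 C T. (C, T) \<in> Cuts (\<zeta>1 + \<zeta>2) \<longrightarrow>
        c (\<zeta>1 + \<zeta>2) (C, T) =
          (\<Sum>((C1, T1), (C2, T2)) \<in> {((C1, T1), (C2, T2)).
              (C1, T1) \<in> Cuts \<zeta>1 \<and> (C2, T2) \<in> Cuts \<zeta>2 \<and> C1 + C2 = C \<and> T1 + T2 = T}.
            c \<zeta>1 (C1, T1) * c \<zeta>2 (C2, T2)))"

definition cut_mult :: "'i forest \<Rightarrow> 'i forest \<times> 'i forest \<Rightarrow> nat" where
  "cut_mult = (THE c. is_cut_mult c)"

primrec tree_cut_poly :: "'i tree \<Rightarrow> ('i forest \<times> 'i forest \<Rightarrow>\<^sub>0 nat)" where
  "tree_cut_poly (Node i \<zeta>) = Poly_Mapping.single ({#Node i \<zeta>#}, {#}) 1 +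
     (let q = \<Prod>\<^sub># (image_mset tree_cut_poly \<zeta>) in
      \<Sum>(C, T)\<in>Poly_Mapping.keys q. Poly_Mapping.single (C, {#Node i T#}) (Poly_Mapping.lookup q (C, T)))"

definition cut_poly :: "'i forest \<Rightarrow> ('i forest \<times> 'i forest \<Rightarrow>\<^sub>0 nat)" where
  "cut_poly \<zeta> = \<Prod>\<^sub># (image_mset tree_cut_poly \<zeta>)"

lemma cut_poly_add: "cut_poly (\<zeta>1 + \<zeta>2) = cut_poly \<zeta>1 * cut_poly \<zeta>2"
  by (simp add: cut_poly_def)

lemma cut_poly_tree:
  "cut_poly {#Node i \<zeta>#} = Poly_Mapping.single ({#Node i \<zeta>#}, {#}) 1 +
     (\<Sum>(C, T)\<in>Poly_Mapping.keys (cut_poly \<zeta>).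
        Poly_Mapping.single (C, {#Node i T#}) (Poly_Mapping.lookup (cut_poly \<zeta>) (C, T)))"
  by (simp add: cut_poly_def Let_def)

lemma keys_cut_poly: "Poly_Mapping.keys (cut_poly \<zeta>) \<subseteq> Cuts \<zeta>"
proof (induction \<zeta> rule: forest_induct)
  case empty
  thus ?case by (simp add: cut_poly_def Cuts_empty zero_prod_def)
next
  case (node i \<zeta>)
  show ?case unfolding cut_poly_tree
  proof (intro order.trans[OF keys_add] Un_least order.trans[OF keys_sum] UN_least)
    fix p assume "p \<in> Poly_Mapping.keys (cut_poly \<zeta>)"
    thus "Poly_Mapping.keys (case p of (C, T) \<Rightarrow> 
        Poly_Mapping.single (C, {#Node i T#}) (Poly_Mapping.lookup (cut_poly \<zeta>) (C, T))) \<subseteq> Cuts {#Node i \<zeta>#}"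
      using node.IH by (cases p) (auto simp: Cuts_tree)
  qed (auto simp: Cuts_tree)
next
  case (join \<tau> \<zeta>)
  show ?case
  proof
    fix p assume "p \<in> Poly_Mapping.keys (cut_poly ({#\<tau>#} + \<zeta>))"
    then obtain a b where "p = a + b" "a \<in> Cuts {#\<tau>#}" "b \<in> Cuts \<zeta>"
      unfolding cut_poly_add using join.IH keys_mult[of "cut_poly {#\<tau>#}" "cut_poly \<zeta>"] by blast
    thus "p \<in> Cuts ({#\<tau>#} + \<zeta>)"
      unfolding Cuts_add by (cases a, cases b) auto
  qed
qed

lemma lookup_cut_poly_tree:
  "Poly_Mapping.lookup (cut_poly {#Node i \<zeta>#}) (C, {#Node i T#}) = Poly_Mapping.lookup (cut_poly \<zeta>) (C, T)"
  "Poly_Mapping.lookup (cut_poly {#Node i \<zeta>#}) ({#Node i \<zeta>#}, {#}) = 1"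
proof -
  show "Poly_Mapping.lookup (cut_poly {#Node i \<zeta>#}) ({#Node i \<zeta>#}, {#}) = 1"
    unfolding cut_poly_tree by (auto simp: lookup_add lookup_sum lookup_single when_def case_prod_unfold intro!: sum.neutral)
  have "Poly_Mapping.lookup (cut_poly {#Node i \<zeta>#}) (C, {#Node i T#}) =
     (\<Sum>p\<in>Poly_Mapping.keys (cut_poly \<zeta>). if p = (C, T) then Poly_Mapping.lookup (cut_poly \<zeta>) p else 0)"
    unfolding cut_poly_tree
    by (simp add: lookup_add lookup_sum lookup_single case_prod_unfold del: sum.delta sum.delta',
        rule sum.cong) (auto simp: when_def)
  also have "\<dots> = Poly_Mapping.lookup (cut_poly \<zeta>) (C, T)"
    by (simp add: in_keys_iff)
  finally show "Poly_Mapping.lookup (cut_poly {#Node i \<zeta>#}) (C, {#Node i T#}) = Poly_Mapping.lookup (cut_poly \<zeta>) (C, T)" .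
qed

lemma is_cut_mult_cut_poly: "is_cut_mult (\<lambda>\<zeta>. Poly_Mapping.lookup (cut_poly \<zeta>))"
  unfolding is_cut_mult_def
proof (intro conjI allI impI)
  fix \<zeta> and p :: "'a forest \<times> 'a forest" assume "p \<notin> Cuts \<zeta>"
  thus "Poly_Mapping.lookup (cut_poly \<zeta>) p = 0"
    using keys_cut_poly[of \<zeta>] by (auto simp: in_keys_iff)
next
  show "Poly_Mapping.lookup (cut_poly {#}) ({#}, {#} :: 'a forest) = 1"
    by (simp add: cut_poly_def lookup_one zero_prod_def)
next
  fix \<tau> :: "'a tree"
  show "Poly_Mapping.lookup (cut_poly {#\<tau>#}) ({#\<tau>#}, {#}) = 1"
    by (cases \<tau>) (simp only: lookup_cut_poly_tree)
next
  fix i :: 'a and \<zeta> C T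
  show "Poly_Mapping.lookup (cut_poly {#Node i \<zeta>#}) (C, {#Node i T#}) = Poly_Mapping.lookup (cut_poly \<zeta>) (C, T)"
    by (rule lookup_cut_poly_tree)
next
  fix \<zeta>1 \<zeta>2 C T :: "'a forest"
  show "Poly_Mapping.lookup (cut_poly (\<zeta>1 + \<zeta>2)) (C, T) =
          (\<Sum>((C1, T1), (C2, T2)) \<in> {((C1, T1), (C2, T2)).
              (C1, T1) \<in> Cuts \<zeta>1 \<and> (C2, T2) \<in> Cuts \<zeta>2 \<and> C1 + C2 = C \<and> T1 + T2 = T}.
            Poly_Mapping.lookup (cut_poly \<zeta>1) (C1, T1) * Poly_Mapping.lookup (cut_poly \<zeta>2) (C2, T2))"
    unfolding cut_poly_add
      lookup_mult_on[OF finite_Cuts keys_cut_poly finite_Cuts keys_cut_poly]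
    by (rule sum.cong) auto
qed

lemma is_cut_multD:
  assumes "is_cut_mult c"
  shows "p \<notin> Cuts \<zeta> \<Longrightarrow> c \<zeta> p = 0"
    and "c {#} ({#}, {#}) = 1"
    and "c {#\<tau>#} ({#\<tau>#}, {#}) = 1"
    and "(C, T) \<in> Cuts \<zeta> \<Longrightarrow> c {#Node i \<zeta>#} (C, {#Node i T#}) = c \<zeta> (C, T)"
    and "(C, T) \<in> Cuts (\<zeta>1 + \<zeta>2) \<Longrightarrow>
        c (\<zeta>1 + \<zeta>2) (C, T) =
          (\<Sum>((C1, T1), (C2, T2)) \<in> {((C1, T1), (C2, T2)).
              (C1, T1) \<in> Cuts \<zeta>1 \<and> (C2, T2) \<in> Cuts \<zeta>2 \<and> C1 + C2 = C \<and> T1 + T2 = T}.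
            c \<zeta>1 (C1, T1) * c \<zeta>2 (C2, T2))"
  using assms unfolding is_cut_mult_def by blast+

lemma is_cut_mult_unique:
  assumes c: "is_cut_mult c" and d: "is_cut_mult d"
  shows "c = d"
proof -
  have "c \<zeta> p = d \<zeta> p" for \<zeta> p
  proof (induction \<zeta> arbitrary: p rule: forest_induct)
    case empty
    show ?case
      by (cases "p = ({#}, {#})")
         (simp_all add: Cuts_empty is_cut_multD(1,2)[OF c] is_cut_multD(1,2)[OF d])
  next
    case (node i \<zeta>)
    show ?case
    proof (cases "p \<in> Cuts {#Node i \<zeta>#}")
      case True
      then consider "p = ({#Node i \<zeta>#}, {#})" | C T where "(C, T) \<in> Cuts \<zeta>" "p = (C, {#Node i T#})"
        by (auto simp: Cuts_tree)
      thus ?thesis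
      proof cases
        case 1
        thus ?thesis by (simp only: is_cut_multD(3)[OF c] is_cut_multD(3)[OF d])
      next
        case 2
        have "c {#Node i \<zeta>#} p = c \<zeta> (C, T)" "d {#Node i \<zeta>#} p = d \<zeta> (C, T)"
          using 2 by (simp_all only: is_cut_multD(4)[OF c] is_cut_multD(4)[OF d])
        thus ?thesis using node.IH by simp
      qed
    next
      case False
      thus ?thesis by (simp add: is_cut_multD(1)[OF c] is_cut_multD(1)[OF d])
    qed
  next
    case (join \<tau> \<zeta>)
    show ?case
    proof (cases "p \<in> Cuts ({#\<tau>#} + \<zeta>)")
      case True
      obtain C T where p: "p = (C, T)" by (cases p)
      let ?A = "{((C1, T1), (C2, T2)). (C1, T1) \<in> Cuts {#\<tau>#} \<and> (C2, T2) \<in> Cuts \<zeta> \<and> C1 + C2 = C \<and> T1 + T2 = T}"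
      have "c ({#\<tau>#} + \<zeta>) p = (\<Sum>((C1, T1), (C2, T2)) \<in> ?A. c {#\<tau>#} (C1, T1) * c \<zeta> (C2, T2))"
        "d ({#\<tau>#} + \<zeta>) p = (\<Sum>((C1, T1), (C2, T2)) \<in> ?A. d {#\<tau>#} (C1, T1) * d \<zeta> (C2, T2))"
        using True unfolding p by (rule is_cut_multD(5)[OF c], rule is_cut_multD(5)[OF d])
      thus ?thesis using join.IH by simp
    next
      case False
      thus ?thesis by (simp add: is_cut_multD(1)[OF c] is_cut_multD(1)[OF d])
    qed
  qed
  thus ?thesis by blast
qed

theorem ex1_cut_mult: "\<exists>!c. is_cut_mult c"
  using is_cut_mult_cut_poly is_cut_mult_unique by blast

lemma is_cut_mult_cut_mult: "is_cut_mult cut_mult"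
  unfolding cut_mult_def by (rule theI'[OF ex1_cut_mult])

context
  notes conj_cong [fundef_cong]
begin

function Splits :: "'i forest \<Rightarrow> 'i forest set" where
  "Splits \<zeta> =
     (if \<zeta> = {#} then {{#}}
      else {C + S | C S. \<exists>T. (C, T) \<in> Cuts \<zeta> \<and> T \<noteq> \<zeta> \<and> S \<in> Splits T})"
  by auto
termination
  by (relation "measure nodes") (auto intro: Cuts_nodes_less)

end

declare Splits.simps [simp del]

lemma Splits_empty [simp]: "Splits {#} = {{#}}"
  by (simp add: Splits.simps)

lemma Splits_nonempty:
  "\<zeta> \<noteq> {#} \<Longrightarrow> Splits \<zeta> = {C + S | C S. \<exists>T. T \<noteq> \<zeta> \<and> S \<in> Splits T \<and> (C, T) \<in> Cuts \<zeta>}"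
  by (subst Splits.simps) auto

lemma finite_Splits: "finite (Splits \<zeta>)"
proof (induction \<zeta> rule: measure_induct_rule[of nodes])
  case (less \<zeta>)
  show ?case
  proof (cases "\<zeta> = {#}")
    case False
    have "Splits \<zeta> \<subseteq> (\<Union>(C, T)\<in>{p \<in> Cuts \<zeta>. snd p \<noteq> \<zeta>}. (+) C ` Splits T)"
      unfolding Splits_nonempty[OF False] by fastforce
    moreover have "finite \<dots>"
      by (intro finite_UN_I) (auto simp: finite_Cuts intro!: finite_imageI less Cuts_nodes_less)
    ultimately show ?thesis by (rule finite_subset)
  qed simp
qed

lemma Splits_subset_add:
  "A \<in> Splits \<zeta> \<Longrightarrow> B \<in> Splits \<xi> \<Longrightarrow> A + B \<in> Splits (\<zeta> + \<xi>)"
proof (induction "nodes \<zeta> + nodes \<xi>" arbitrary: \<zeta> \<xi> A B rule: less_induct)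
  case less
  have step: "\<exists>C T S. (C, T) \<in> Cuts \<zeta> \<and> S \<in> Splits T \<and> A = C + S \<and> (\<zeta> \<noteq> {#} \<longrightarrow> T \<noteq> \<zeta>)"
    if "A \<in> Splits \<zeta>" for A \<zeta> :: "'a forest"
  proof (cases "\<zeta> = {#}")
    case True
    thus ?thesis using that by (auto simp: Cuts_empty)
  next
    case False
    thus ?thesis using that by (auto simp: Splits_nonempty)
  qed
  show ?case
  proof (cases "\<zeta> + \<xi> = {#}")
    case True
    thus ?thesis using less.prems by simp
  next
    case False
    obtain C1 T1 S1 where 1: "(C1, T1) \<in> Cuts \<zeta>" "S1 \<in> Splits T1" "A = C1 + S1" "\<zeta> \<noteq> {#} \<longrightarrow> T1 \<noteq> \<zeta>"
      using step[OF less.prems(1)] by blast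
    obtain C2 T2 S2 where 2: "(C2, T2) \<in> Cuts \<xi>" "S2 \<in> Splits T2" "B = C2 + S2" "\<xi> \<noteq> {#} \<longrightarrow> T2 \<noteq> \<xi>"
      using step[OF less.prems(2)] by blast
    have lt: "nodes T1 + nodes T2 < nodes \<zeta> + nodes \<xi>"
      using Cuts_nodes[OF 1(1)] Cuts_nodes[OF 2(1)] Cuts_nodes_less[OF 1(1)] Cuts_nodes_less[OF 2(1)]
        1(4) 2(4) False by fastforce
    hence "S1 + S2 \<in> Splits (T1 + T2)"
      using 1 2 less.hyps by blast
    moreover have "(C1 + C2, T1 + T2) \<in> Cuts (\<zeta> + \<xi>)"
      using 1 2 unfolding Cuts_add by blast
    moreover have "T1 + T2 \<noteq> \<zeta> + \<xi>"
      using lt nodes_simps(3) by (metis less_irrefl)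
    moreover have "A + B = (C1 + C2) + (S1 + S2)"
      using 1 2 by (simp add: ac_simps)
    ultimately show ?thesis
      unfolding Splits_nonempty[OF False] by blast
  qed
qed

(* The defining recursion of the coefficients s_\<zeta>, extended by zero outside Splits(\<zeta>);
   ex1_split_coeff shows that it has exactly one solution. *)
definition is_split_coeff :: "('i forest \<Rightarrow> 'i forest \<Rightarrow> int) \<Rightarrow> bool" where
  "is_split_coeff s \<longleftrightarrow>
     (\<forall>\<zeta> S. S \<notin> Splits \<zeta> \<longrightarrow> s \<zeta> S = 0) \<and>
     s {#} {#} = 1 \<and>
     (\<forall>i \<zeta> S'. S' \<in> Splits {#Node i \<zeta>#} \<longrightarrow>
        s {#Node i \<zeta>#} S' =
          - (\<Sum>((C, T), S) \<in> {((C, T), S).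
               (C, T) \<in> Cuts {#Node i \<zeta>#} \<and> S \<in> Splits T \<and> T \<noteq> {#Node i \<zeta>#} \<and> C + S = S'}.
             s T S * int (cut_mult {#Node i \<zeta>#} (C, T)))) \<and>
     (\<forall>\<zeta>1 \<zeta>2 S. S \<in> Splits (\<zeta>1 + \<zeta>2) \<longrightarrow>
        s (\<zeta>1 + \<zeta>2) S =
          (\<Sum>(S1, S2) \<in> {(S1, S2). S1 \<in> Splits \<zeta>1 \<and> S2 \<in> Splits \<zeta>2 \<and> S1 + S2 = S}.
             s \<zeta>1 S1 * s \<zeta>2 S2))"

definition split_coeff :: "'i forest \<Rightarrow> 'i forest \<Rightarrow> int" where
  "split_coeff = (THE s. is_split_coeff s)"

function tree_split_poly :: "'i tree \<Rightarrow> ('i forest \<Rightarrow>\<^sub>0 int)" where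
  "tree_split_poly \<tau> =
     - (\<Sum>p\<in>{p \<in> Cuts {#\<tau>#}. snd p \<noteq> {#\<tau>#}}.
          Poly_Mapping.single (fst p) (int (cut_mult {#\<tau>#} p)) *
          \<Prod>\<^sub># (image_mset tree_split_poly (snd p)))"
  by auto
termination
proof (relation "measure tree_nodes")
  fix \<tau> :: "'i tree" and p \<sigma>
  assume "p \<in> {p \<in> Cuts {#\<tau>#}. snd p \<noteq> {#\<tau>#}}" "\<sigma> \<in># snd p"
  thus "(\<sigma>, \<tau>) \<in> measure tree_nodes"
    using Cuts_nodes_less[of "fst p" "snd p" "{#\<tau>#}"] tree_nodes_le[of \<sigma> "snd p"] by simp
qed simp

declare tree_split_poly.simps [simp del]

definition split_poly :: "'i forest \<Rightarrow> ('i forest \<Rightarrow>\<^sub>0 int)" where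
  "split_poly \<zeta> = \<Prod>\<^sub># (image_mset tree_split_poly \<zeta>)"

lemma split_poly_add: "split_poly (\<zeta>1 + \<zeta>2) = split_poly \<zeta>1 * split_poly \<zeta>2"
  by (simp add: split_poly_def)

lemma split_poly_tree:
  "split_poly {#\<tau>#} = - (\<Sum>p\<in>{p \<in> Cuts {#\<tau>#}. snd p \<noteq> {#\<tau>#}}.
     Poly_Mapping.single (fst p) (int (cut_mult {#\<tau>#} p)) * split_poly (snd p))"
  by (simp add: split_poly_def tree_split_poly.simps[of \<tau>])

lemma keys_split_poly: "Poly_Mapping.keys (split_poly \<zeta>) \<subseteq> Splits \<zeta>"
proof (induction \<zeta> rule: measure_induct_rule[of nodes])
  case (less \<zeta>)
  have tree: "Poly_Mapping.keys (split_poly {#\<tau>#}) \<subseteq> Splits {#\<tau>#}" if "\<tau> \<in># \<zeta>" for \<tau>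
    unfolding split_poly_tree keys_minus
  proof (intro order.trans[OF keys_sum] UN_least subsetI)
    fix p S assume p: "p \<in> {p \<in> Cuts {#\<tau>#}. snd p \<noteq> {#\<tau>#}}"
      and "S \<in> Poly_Mapping.keys (Poly_Mapping.single (fst p) (int (cut_mult {#\<tau>#} p)) * split_poly (snd p))"
    then obtain S' where S: "S = fst p + S'" "S' \<in> Poly_Mapping.keys (split_poly (snd p))"
      using keys_mult[of "Poly_Mapping.single (fst p) (int (cut_mult {#\<tau>#} p))" "split_poly (snd p)"]
      by (auto split: if_splits)
    have "nodes (snd p) < nodes \<zeta>"
      using p Cuts_nodes_less[of "fst p" "snd p" "{#\<tau>#}"] tree_nodes_le[OF that] by simp
    hence "S' \<in> Splits (snd p)" using S less by blast
    thus "S \<in> Splits {#\<tau>#}"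
      using p S(1) by (subst Splits_nonempty) (simp, cases p, auto)
  qed
  have "Poly_Mapping.keys (split_poly \<xi>) \<subseteq> Splits \<xi>" if "\<xi> \<subseteq># \<zeta>" for \<xi>
    using that
  proof (induction \<xi>)
    case empty
    show ?case by (simp add: split_poly_def)
  next
    case (add \<tau> \<xi>)
    have "\<tau> \<in># \<zeta>" "\<xi> \<subseteq># \<zeta>"
      using add.prems mset_subset_eq_insertD[OF add.prems]
      by (simp_all add: insert_subset_eq_iff subset_mset.less_imp_le)
    hence "Poly_Mapping.keys (split_poly ({#\<tau>#} + \<xi>)) \<subseteq> Splits ({#\<tau>#} + \<xi>)"
      unfolding split_poly_add using tree add.IH Splits_subset_add
      by (intro order.trans[OF keys_mult]) blast
    thus ?case by simp
  qed
  thus ?case by blast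
qed

lemma is_split_coeff_split_poly: "is_split_coeff (\<lambda>\<zeta>. Poly_Mapping.lookup (split_poly \<zeta>))"
  unfolding is_split_coeff_def
proof (intro conjI allI impI)
  fix \<zeta> S :: "'a forest" assume "S \<notin> Splits \<zeta>"
  thus "Poly_Mapping.lookup (split_poly \<zeta>) S = 0"
    using keys_split_poly[of \<zeta>] by (auto simp: in_keys_iff)
next
  show "Poly_Mapping.lookup (split_poly {#}) ({#} :: 'a forest) = 1"
    by (simp add: split_poly_def lookup_one)
next
  fix i :: 'a and \<zeta> S'
  let ?\<tau> = "{#Node i \<zeta>#}"
  let ?A = "{p \<in> Cuts ?\<tau>. snd p \<noteq> ?\<tau>}"
  have fin: "finite ?A" by (rule finite_subset[OF _ finite_Cuts]) blast
  have "Poly_Mapping.lookup (Poly_Mapping.single (fst p) (int (cut_mult ?\<tau> p)) * split_poly (snd p)) S' =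
      (\<Sum>S\<in>{S \<in> Splits (snd p). fst p + S = S'}.
         Poly_Mapping.lookup (split_poly (snd p)) S * int (cut_mult ?\<tau> p))" for p
  proof -
    have "Poly_Mapping.single (fst p) (int (cut_mult ?\<tau> p)) * split_poly (snd p) =
        (\<Sum>S\<in>Splits (snd p). Poly_Mapping.single (fst p + S) (int (cut_mult ?\<tau> p) * Poly_Mapping.lookup (split_poly (snd p)) S))"
      by (subst poly_expand[OF finite_Splits keys_split_poly]) (simp add: sum_distrib_left mult_single)
    also have "Poly_Mapping.lookup \<dots> S' = 
       (\<Sum>S\<in>Splits (snd p). if fst p + S = S' then Poly_Mapping.lookup (split_poly (snd p)) S * int (cut_mult ?\<tau> p) else 0)"
      by (auto simp: lookup_sum lookup_single when_def intro!: sum.cong)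
    also have "\<dots> = (\<Sum>S\<in>{S \<in> Splits (snd p). fst p + S = S'}.
         Poly_Mapping.lookup (split_poly (snd p)) S * int (cut_mult ?\<tau> p))"
      by (rule sum.inter_filter[OF finite_Splits, symmetric])
    finally show ?thesis .
  qed
  hence "Poly_Mapping.lookup (split_poly ?\<tau>) S' = - (\<Sum>p\<in>?A. \<Sum>S\<in>{S \<in> Splits (snd p). fst p + S = S'}.
         Poly_Mapping.lookup (split_poly (snd p)) S * int (cut_mult ?\<tau> p))"
    unfolding split_poly_tree by (simp add: lookup_sum)
  also have "\<dots> = - (\<Sum>((C, T), S) \<in> {((C, T), S).
               (C, T) \<in> Cuts ?\<tau> \<and> S \<in> Splits T \<and> T \<noteq> ?\<tau> \<and> C + S = S'}.
             Poly_Mapping.lookup (split_poly T) S * int (cut_mult ?\<tau> (C, T)))"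
    by (subst sum.Sigma[OF fin])
       (auto intro!: sum.cong finite_subset[OF _ finite_Splits])
  finally show "Poly_Mapping.lookup (split_poly ?\<tau>) S' = \<dots>" .
next
  fix \<zeta>1 \<zeta>2 S :: "'a forest"
  show "Poly_Mapping.lookup (split_poly (\<zeta>1 + \<zeta>2)) S =
          (\<Sum>(S1, S2) \<in> {(S1, S2). S1 \<in> Splits \<zeta>1 \<and> S2 \<in> Splits \<zeta>2 \<and> S1 + S2 = S}.
            Poly_Mapping.lookup (split_poly \<zeta>1) S1 * Poly_Mapping.lookup (split_poly \<zeta>2) S2)"
    unfolding split_poly_add by (rule lookup_mult_on[OF finite_Splits keys_split_poly finite_Splits keys_split_poly])
qed

lemma is_split_coeffD:
  assumes "is_split_coeff s"
  shows "S \<notin> Splits \<zeta> \<Longrightarrow> s \<zeta> S = 0"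
    and "s {#} {#} = 1"
    and "S' \<in> Splits {#Node i \<zeta>#} \<Longrightarrow>
        s {#Node i \<zeta>#} S' =
          - (\<Sum>((C, T), S) \<in> {((C, T), S).
               (C, T) \<in> Cuts {#Node i \<zeta>#} \<and> S \<in> Splits T \<and> T \<noteq> {#Node i \<zeta>#} \<and> C + S = S'}.
             s T S * int (cut_mult {#Node i \<zeta>#} (C, T)))"
    and "S \<in> Splits (\<zeta>1 + \<zeta>2) \<Longrightarrow>
        s (\<zeta>1 + \<zeta>2) S =
          (\<Sum>(S1, S2) \<in> {(S1, S2). S1 \<in> Splits \<zeta>1 \<and> S2 \<in> Splits \<zeta>2 \<and> S1 + S2 = S}.
             s \<zeta>1 S1 * s \<zeta>2 S2)"
  using assms unfolding is_split_coeff_def by blast+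

lemma is_split_coeff_unique:
  assumes s: "is_split_coeff s" and t: "is_split_coeff t"
  shows "s = t"
proof -
  have "s \<zeta> S = t \<zeta> S" for \<zeta> S
  proof (induction \<zeta> arbitrary: S rule: measure_induct_rule[of nodes])
    case (less \<zeta>)
    consider "S \<notin> Splits \<zeta>" | "\<zeta> = {#}" "S = {#}" | i \<zeta>' where "\<zeta> = {#Node i \<zeta>'#}" "S \<in> Splits \<zeta>"
      | \<tau> \<xi> where "\<zeta> = {#\<tau>#} + \<xi>" "\<xi> \<noteq> {#}" "S \<in> Splits \<zeta>"
    proof (cases \<zeta>)
      case (add \<tau> \<xi>)
      show ?thesis
        using that add by (cases "S \<in> Splits \<zeta>"; cases "\<xi> = {#}"; cases \<tau>) auto
    qed (use that in auto)
    thus ?case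
    proof cases
      case 1
      thus ?thesis by (simp add: is_split_coeffD(1)[OF s] is_split_coeffD(1)[OF t])
    next
      case 2
      thus ?thesis by (simp add: is_split_coeffD(2)[OF s] is_split_coeffD(2)[OF t])
    next
      case 3
      let ?A = "{((C, T), S'). (C, T) \<in> Cuts {#Node i \<zeta>'#} \<and> S' \<in> Splits T \<and> T \<noteq> {#Node i \<zeta>'#} \<and> C + S' = S}"
      have *: "s \<zeta> S = - (\<Sum>((C, T), S) \<in> ?A. s T S * int (cut_mult {#Node i \<zeta>'#} (C, T)))"
        "t \<zeta> S = - (\<Sum>((C, T), S) \<in> ?A. t T S * int (cut_mult {#Node i \<zeta>'#} (C, T)))"
        using 3(2) unfolding 3(1) by (rule is_split_coeffD(3)[OF s], rule is_split_coeffD(3)[OF t])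
      have IH: "s T S' = t T S'" if "(C, T) \<in> Cuts {#Node i \<zeta>'#}" "T \<noteq> {#Node i \<zeta>'#}" for C T S'
        using less.IH Cuts_nodes_less[OF that] 3(1) by blast
      have "(\<Sum>((C, T), S) \<in> ?A. s T S * int (cut_mult {#Node i \<zeta>'#} (C, T))) =
         (\<Sum>((C, T), S) \<in> ?A. t T S * int (cut_mult {#Node i \<zeta>'#} (C, T)))"
        by (intro sum.cong) (auto dest: IH)
      thus ?thesis using * by simp
    next
      case 4
      have lt: "nodes {#\<tau>#} < nodes \<zeta>" "nodes \<xi> < nodes \<zeta>"
        using 4 nodes_eq_0[of \<xi>] tree_nodes_pos[of \<tau>] by auto
      let ?A = "{(S1, S2). S1 \<in> Splits {#\<tau>#} \<and> S2 \<in> Splits \<xi> \<and> S1 + S2 = S}"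
      have "s ({#\<tau>#} + \<xi>) S = (\<Sum>(S1, S2) \<in> ?A. s {#\<tau>#} S1 * s \<xi> S2)"
        "t ({#\<tau>#} + \<xi>) S = (\<Sum>(S1, S2) \<in> ?A. t {#\<tau>#} S1 * t \<xi> S2)"
        using 4(3) unfolding 4(1) by (rule is_split_coeffD(4)[OF s], rule is_split_coeffD(4)[OF t])
      thus ?thesis using less.IH[OF lt(1)] less.IH[OF lt(2)] 4(1) by simp
    qed
  qed
  thus ?thesis by blast
qed

theorem ex1_split_coeff: "\<exists>!s. is_split_coeff s"
  using is_split_coeff_split_poly is_split_coeff_unique by blast

lemma is_split_coeff_split_coeff: "is_split_coeff split_coeff"
  unfolding split_coeff_def by (rule theI'[OF ex1_split_coeff])

end

theory Submission
  imports Defs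
begin

text \<open>
  The recursion that defines the split coefficients says that the generating element
  \<open>R \<zeta> = (\<Sum>S. s\<^sub>\<zeta>(S) S)\<close>, called \<open>split_element\<close> below, satisfies
  \<open>R \<tau> = - (\<Sum>(C, T). c\<^sub>\<tau>(C, T) C (R T))\<close> on a tree \<open>\<tau>\<close>, the sum ranging over the cuts with
  \<open>T \<noteq> \<tau>\<close>: the inverse is applied to the trunk. The antipode is defined by the mirrored recursion,
  which applies it to the pruned branches. So \<open>R\<close> is a right and the antipode a left inverse of
  the inclusion of forests (\<open>basis\<close>) for the convolution product
  \<open>(F \<star> G) \<zeta> = m (F \<otimes> G) (\<Delta> \<zeta>)\<close>, and in a monoid a left and a right inverse coincide.

  Four facts make this precise. The cut multiplicities are the coordinates of the coproduct
  (\<open>coproduct_eq_cut_poly\<close>), which turns the sum over cuts into a convolution. The coproduct is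
  coassociative (\<open>coassociativity\<close>) and has a counit (\<open>convolution_counit_left\<close>,
  \<open>convolution_counit_right\<close>), which makes the convolution product a monoid. Finally \<open>R\<close> is
  multiplicative, so that it suffices to verify \<open>basis \<star> R = \<epsilon>\<close> on trees (\<open>convolution_basis_split\<close>).
\<close>

section \<open>Linear extensions and change of coefficients\<close>

lemma linear_lin_ext_comp:
  assumes "linear g"
  shows "g (lin_ext f p) = lin_ext (\<lambda>x. g (f x)) p"
  by (simp add: lin_ext_def linear_sum[OF assms] linear_scale[OF assms])

lemma lin_ext_add: "lin_ext f (p + q) = lin_ext f p + lin_ext f q"
  by (rule linear_add[OF linear_lin_ext])

lemma basis_add: "basis (a + b) = basis a * (basis b :: 'a::comm_monoid_add \<Rightarrow>\<^sub>0 real)"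
  by (simp add: mult_single)

lemma lookup_map_zero:
  "\<phi> 0 = 0 \<Longrightarrow> Poly_Mapping.lookup (Poly_Mapping.map \<phi> p) k = \<phi> (Poly_Mapping.lookup p k)"
  by transfer (simp add: when_def)

lemma map_mult_hom:
  fixes \<phi> :: "'b::comm_semiring_1 \<Rightarrow> 'c::comm_semiring_1"
    and p q :: "'a::comm_monoid_add \<Rightarrow>\<^sub>0 'b"
  assumes "\<phi> 0 = 0" "\<And>a b. \<phi> (a + b) = \<phi> a + \<phi> b" "\<And>a b. \<phi> (a * b) = \<phi> a * \<phi> b"
  shows "Poly_Mapping.map \<phi> (p * q) = Poly_Mapping.map \<phi> p * Poly_Mapping.map \<phi> q"
proof (rule poly_mapping_eqI)
  fix k
  let ?A = "Poly_Mapping.keys p" and ?B = "Poly_Mapping.keys q"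
  have sum: "\<phi> (sum f X) = (\<Sum>x\<in>X. \<phi> (f x))" for f and X :: "('a \<times> 'a) set"
    by (induction X rule: infinite_finite_induct) (simp_all add: assms)
  have keys: "Poly_Mapping.keys (Poly_Mapping.map \<phi> r) \<subseteq> Poly_Mapping.keys r" for r :: "'a \<Rightarrow>\<^sub>0 'b"
    by (auto simp: in_keys_iff lookup_map_zero assms(1))
  show "Poly_Mapping.lookup (Poly_Mapping.map \<phi> (p * q)) k =
      Poly_Mapping.lookup (Poly_Mapping.map \<phi> p * Poly_Mapping.map \<phi> q) k"
    unfolding lookup_map_zero[of \<phi>, OF assms(1)]
      lookup_mult_on[OF finite_keys[of p] order.refl finite_keys[of q] order.refl]
      lookup_mult_on[OF finite_keys[of p] keys[of p] finite_keys[of q] keys[of q]]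
    by (simp add: sum assms(3) lookup_map_zero[of \<phi>, OF assms(1)] case_prod_unfold)
qed

section \<open>Cut multiplicities as coordinates of the coproduct\<close>

lemma coproduct_one_basis: "coproduct 1 = basis ({#}, {#})"
  using coproduct_one unfolding one_basis tensor_basis .

lemma coproduct_basis_Node:
  "coproduct (basis {#Node i \<zeta>#}) = basis ({#Node i \<zeta>#}, {#}) +
     lin_ext (\<lambda>(C, T). basis (C, {#Node i T#})) (coproduct (basis \<zeta>))"
  by (simp add: coproduct_basis tensor_map_def)

lemma coproduct_basis_add:
  "coproduct (basis (\<zeta>1 + \<zeta>2)) = coproduct (basis \<zeta>1) * coproduct (basis \<zeta>2)"
  by (simp add: coproduct_basis)

text \<open>Both sides satisfy the same recursion over the structure of \<open>\<zeta>\<close>; only the coefficients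
  differ, being natural numbers on the one side and reals on the other.\<close>
lemma coproduct_eq_cut_poly: "coproduct (basis \<zeta>) = Poly_Mapping.map real (cut_poly \<zeta>)"
proof (induction \<zeta> rule: forest_induct)
  case empty
  show ?case
    by (rule poly_mapping_eqI)
       (simp add: coproduct_one_basis cut_poly_def lookup_map_zero lookup_one lookup_single
         zero_prod_def when_def)
next
  case (node i \<zeta>)
  let ?K = "Poly_Mapping.keys (cut_poly \<zeta>)"
  have "lin_ext (\<lambda>(C, T). basis (C, {#Node i T#})) (coproduct (basis \<zeta>)) =
      (\<Sum>p\<in>?K. real (Poly_Mapping.lookup (cut_poly \<zeta>) p) *\<^sub>R basis (fst p, {#Node i (snd p)#}))"
    unfolding node.IH
    by (subst lin_ext_superset[of ?K])
       (auto simp: in_keys_iff lookup_map_zero case_prod_unfold)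
  thus ?case
    unfolding coproduct_basis_Node cut_poly_tree
    by (intro poly_mapping_eqI)
       (auto simp: lookup_map_zero lookup_add lookup_sum lookup_single lookup_scaleR
         case_prod_unfold when_def intro!: sum.cong)
next
  case (join \<tau> \<zeta>)
  thus ?case
    by (simp only: coproduct_basis_add cut_poly_add map_mult_hom of_nat_0 of_nat_add of_nat_mult)
qed

lemma cut_mult_eq: "cut_mult = (\<lambda>\<zeta>. Poly_Mapping.lookup (cut_poly \<zeta>))"
  by (rule is_cut_mult_unique[OF is_cut_mult_cut_mult is_cut_mult_cut_poly])

lemma lin_ext_coproduct:
  "lin_ext f (coproduct (basis \<zeta>)) = (\<Sum>p\<in>Cuts \<zeta>. real (cut_mult \<zeta> p) *\<^sub>R f p)"
  unfolding coproduct_eq_cut_poly cut_mult_eq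
  by (subst lin_ext_superset[OF finite_Cuts])
     (use keys_cut_poly[of \<zeta>] in \<open>auto simp: in_keys_iff lookup_map_zero\<close>)

section \<open>The convolution product\<close>

definition convolution ::
  "('i forest \<Rightarrow> 'i forest_alg) \<Rightarrow> ('i forest \<Rightarrow> 'i forest_alg) \<Rightarrow> 'i forest \<Rightarrow> 'i forest_alg"
  (infixl "\<star>" 70) where
  "(F \<star> G) \<zeta> = lin_ext (\<lambda>(a, b). F a * G b) (coproduct (basis \<zeta>))"

definition counit :: "'i forest \<Rightarrow> 'i forest_alg" where
  "counit \<zeta> = (if \<zeta> = {#} then 1 else 0)"

lemma counit_add: "counit (a + b) = counit a * counit b"
  by (simp add: counit_def)

lemma convolution_empty: "(F \<star> G) {#} = F {#} * G {#}"
  by (simp add: convolution_def coproduct_one_basis)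

lemma convolution_add:
  assumes "\<And>a b. F (a + b) = F a * F b" "\<And>a b. G (a + b) = G a * G b"
  shows "(F \<star> G) (\<zeta>1 + \<zeta>2) = (F \<star> G) \<zeta>1 * (F \<star> G) \<zeta>2"
  unfolding convolution_def coproduct_basis_add
  by (rule lin_ext_mult) (auto simp: assms ac_simps)

text \<open>By linearity the case \<open>F = basis\<close> is enough. There all maps are multiplicative, and the claim
  reduces to trees: the counit vanishes on every non-empty trunk, so only the cut that removes the
  whole tree survives.\<close>
lemma convolution_counit_right: "F \<star> counit = F"
proof
  fix \<zeta>
  have "(basis \<star> counit) \<zeta> = (basis \<zeta> :: 'a forest_alg)"
  proof (induction \<zeta> rule: forest_induct)
    case (node i \<zeta>)
    have "lin_ext (\<lambda>(a, b). basis a * counit b)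
        (lin_ext (\<lambda>(C, T). basis (C, {#Node i T#})) (coproduct (basis \<zeta>))) = (0 :: 'a forest_alg)"
      by (subst linear_lin_ext_comp[OF linear_lin_ext])
         (simp add: counit_def case_prod_unfold, simp add: lin_ext_def)
    thus ?case
      by (simp add: convolution_def coproduct_basis_Node lin_ext_add counit_def)
  next
    case (join \<tau> \<zeta>)
    thus ?case by (simp only: convolution_add basis_add counit_add)
  qed (simp add: convolution_empty counit_def)
  hence "lin_ext F ((basis \<star> counit) \<zeta>) = F \<zeta>" by simp
  thus "(F \<star> counit) \<zeta> = F \<zeta>"
    unfolding convolution_def linear_lin_ext_comp[OF linear_lin_ext]
    by (simp add: counit_def case_prod_unfold if_distrib[of "\<lambda>x. _ * x"]
        if_distrib[of "lin_ext F"] linear_0[OF linear_lin_ext] cong: if_cong)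
qed

text \<open>On a tree with branches \<open>\<zeta>\<close> the cut that removes everything is now the one that vanishes, and
  the other cuts are those of \<open>\<zeta>\<close> with the root put back below the trunk.\<close>
lemma convolution_counit_left: "counit \<star> F = F"
proof
  fix \<zeta>
  have "(counit \<star> basis) \<zeta> = (basis \<zeta> :: 'a forest_alg)"
  proof (induction \<zeta> rule: forest_induct)
    case (node i \<zeta>)
    have "lin_ext (\<lambda>(a, b). counit a * basis b)
        (lin_ext (\<lambda>(C, T). basis (C, {#Node i T#})) (coproduct (basis \<zeta>))) =
        graft i ((counit \<star> basis) \<zeta>)"
      unfolding convolution_def graft_def linear_lin_ext_comp[OF linear_lin_ext]
      by (intro lin_ext_cong refl) (auto simp: counit_def linear_0[OF linear_lin_ext])
    thus ?case
      by (simp add: node.IH) (simp add: convolution_def coproduct_basis_Node lin_ext_add counit_def)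
  next
    case (join \<tau> \<zeta>)
    thus ?case by (simp only: convolution_add basis_add counit_add)
  qed (simp add: convolution_empty counit_def)
  hence "lin_ext F ((counit \<star> basis) \<zeta>) = F \<zeta>" by simp
  thus "(counit \<star> F) \<zeta> = F \<zeta>"
    unfolding convolution_def linear_lin_ext_comp[OF linear_lin_ext]
    by (simp add: counit_def case_prod_unfold if_distrib[of "\<lambda>x. x * _"]
        if_distrib[of "lin_ext F"] linear_0[OF linear_lin_ext] cong: if_cong)
qed

section \<open>Coassociativity\<close>

type_synonym 'i forest_tensor3 = "'i forest \<times> 'i forest \<times> 'i forest \<Rightarrow>\<^sub>0 real"

text \<open>The maps \<open>\<Delta> \<otimes> id\<close> and \<open>id \<otimes> \<Delta>\<close>; the threefold tensor power has its own type, with triples of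
  forests as basis, so that both land in the same space.\<close>

definition coproduct_left :: "'i forest_tensor \<Rightarrow> 'i forest_tensor3" where
  "coproduct_left = lin_ext (\<lambda>(a, b). lin_ext (\<lambda>(c, d). basis (c, d, b)) (coproduct (basis a)))"

definition coproduct_right :: "'i forest_tensor \<Rightarrow> 'i forest_tensor3" where
  "coproduct_right = lin_ext (\<lambda>(a, b). lin_ext (\<lambda>(c, d). basis (a, c, d)) (coproduct (basis b)))"

text \<open>A tensor factor that is merely carried along can be split off as a product, leaving an
  algebra homomorphism.\<close>
lemma coproduct_left_mult: "coproduct_left (p * q) = coproduct_left p * coproduct_left q"
proof -
  define E :: "'a forest_tensor \<Rightarrow> 'a forest_tensor3" where
    "E = lin_ext (\<lambda>(c, d). basis (c, d, 0))"
  have E: "E (r * s) = E r * E s" for r s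
    unfolding E_def by (rule lin_ext_mult) (auto simp: mult_single)
  have split: "lin_ext (\<lambda>(c, d). basis (c, d, b)) r = E r * basis (0, 0, b)" for b r
    unfolding E_def linear_lin_ext_comp[OF linear_mult_left]
    by (auto simp: mult_single intro!: lin_ext_cong)
  have b: "basis (0, 0, b + b') =
      (basis (0, 0, b) * basis (0, 0, b') :: 'a forest_tensor3)" for b b'
    by (simp add: mult_single)
  show ?thesis
    unfolding coproduct_left_def split
    by (rule lin_ext_mult) (simp only: case_prod_unfold fst_add snd_add coproduct_basis_add E b mult_ac)
qed

lemma coproduct_right_mult: "coproduct_right (p * q) = coproduct_right p * coproduct_right q"
proof -
  define E :: "'a forest_tensor \<Rightarrow> 'a forest_tensor3" where
    "E = lin_ext (\<lambda>(c, d). basis (0, c, d))"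
  have E: "E (r * s) = E r * E s" for r s
    unfolding E_def by (rule lin_ext_mult) (auto simp: mult_single)
  have split: "lin_ext (\<lambda>(c, d). basis (a, c, d)) r = E r * basis (a, 0, 0)" for a r
    unfolding E_def linear_lin_ext_comp[OF linear_mult_left]
    by (auto simp: mult_single intro!: lin_ext_cong)
  have a: "basis (a + a', 0, 0) =
      (basis (a, 0, 0) * basis (a', 0, 0) :: 'a forest_tensor3)" for a a'
    by (simp add: mult_single)
  show ?thesis
    unfolding coproduct_right_def split
    by (rule lin_ext_mult) (simp only: case_prod_unfold fst_add snd_add coproduct_basis_add E a mult_ac)
qed

text \<open>By multiplicativity only a tree with branches \<open>\<zeta>\<close> needs an argument. Writing \<open>B\<close> for grafting
  onto its root, both sides unfold to
  \<open>B \<zeta> \<otimes> 1 \<otimes> 1 + (id \<otimes> B) (\<Delta> \<zeta>) \<otimes> 1\<close> plus \<open>id \<otimes> id \<otimes> B\<close> applied to the iterated coproduct of \<open>\<zeta>\<close>.\<close>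
lemma coassociativity:
  "coproduct_left (coproduct (basis \<zeta>)) = coproduct_right (coproduct (basis \<zeta>))"
proof (induction \<zeta> rule: forest_induct)
  case empty
  show ?case
    by (simp add: coproduct_left_def coproduct_right_def coproduct_one_basis)
next
  case (node i \<zeta>)
  let ?\<Delta> = "coproduct (basis \<zeta>)"
  let ?B = "lin_ext (\<lambda>(a, b, c). basis (a, b, {#Node i c#})) :: 'a forest_tensor3 \<Rightarrow> 'a forest_tensor3"
  let ?M = "basis ({#Node i \<zeta>#}, {#}, {#}) +
    lin_ext (\<lambda>(a, b). basis (a, {#Node i b#}, {#})) ?\<Delta> :: 'a forest_tensor3"
  have "coproduct_left (coproduct (basis {#Node i \<zeta>#})) = ?M + ?B (coproduct_left ?\<Delta>)"
    unfolding coproduct_left_def coproduct_basis_Node[of i \<zeta>] lin_ext_add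
      linear_lin_ext_comp[OF linear_lin_ext]
    by (simp add: case_prod_unfold linear_lin_ext_comp[OF linear_lin_ext]
        coproduct_basis_Node lin_ext_add)
  also have "?M + ?B (coproduct_left ?\<Delta>) = ?M + ?B (coproduct_right ?\<Delta>)"
    by (simp only: node.IH)
  also have "\<dots> = coproduct_right (coproduct (basis {#Node i \<zeta>#}))"
  proof -
    have sum: "lin_ext (\<lambda>x. f x + g x) p = lin_ext f p + lin_ext g p"
      for f g :: "'a forest \<times> 'a forest \<Rightarrow> 'a forest_tensor3" and p
      by (simp add: lin_ext_def scaleR_add_right sum.distrib)
    show ?thesis
      unfolding coproduct_right_def coproduct_basis_Node[of i \<zeta>] lin_ext_add
        linear_lin_ext_comp[OF linear_lin_ext]
      by (simp add: case_prod_unfold linear_lin_ext_comp[OF linear_lin_ext]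
          coproduct_basis_Node coproduct_one_basis lin_ext_add sum)
  qed
  finally show ?case .
next
  case (join \<tau> \<zeta>)
  thus ?case by (simp only: coproduct_basis_add coproduct_left_mult coproduct_right_mult)
qed

lemma convolution_assoc: "F \<star> G \<star> H = F \<star> (G \<star> H)"
proof
  fix \<zeta>
  let ?m = "lin_ext (\<lambda>(a, b, c). F a * G b * H c)"
  have "(F \<star> G \<star> H) \<zeta> = ?m (coproduct_left (coproduct (basis \<zeta>)))"
    unfolding convolution_def coproduct_left_def
    by (simp add: case_prod_unfold linear_lin_ext_comp[OF linear_lin_ext]
        linear_lin_ext_comp[OF linear_mult_left])
  also have "\<dots> = ?m (coproduct_right (coproduct (basis \<zeta>)))"
    by (simp only: coassociativity)
  also have "\<dots> = (F \<star> (G \<star> H)) \<zeta>"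
    unfolding convolution_def coproduct_right_def
    by (simp add: case_prod_unfold linear_lin_ext_comp[OF linear_lin_ext]
        linear_lin_ext_comp[OF linear_mult_right] mult.assoc)
  finally show "(F \<star> G \<star> H) \<zeta> = (F \<star> (G \<star> H)) \<zeta>" .
qed

section \<open>The two inverses of the inclusion of forests\<close>

lemma convolution_antipode_basis: "(\<lambda>\<zeta>. antipode (basis \<zeta>)) \<star> basis = counit"
proof
  fix \<zeta> :: "'a forest"
  have "((\<lambda>\<zeta>. antipode (basis \<zeta>)) \<star> basis) \<zeta> =
      tensor_mult (tensor_map antipode id (coproduct (basis \<zeta>)))"
    unfolding convolution_def tensor_map_def linear_lin_ext_comp[OF linear_tensor_mult]
    by (simp add: case_prod_unfold tensor_mult_tensor)
  thus "((\<lambda>\<zeta>. antipode (basis \<zeta>)) \<star> basis) \<zeta> = counit \<zeta>"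
    by (simp add: antipode_convolution_id counit_def lookup_single)
qed

definition split_element :: "'i forest \<Rightarrow> 'i forest_alg" where
  "split_element \<zeta> = Poly_Mapping.map real_of_int (split_poly \<zeta>)"

lemma split_element_add: "split_element (\<zeta>1 + \<zeta>2) = split_element \<zeta>1 * split_element \<zeta>2"
  by (simp only: split_element_def split_poly_add map_mult_hom of_int_0 of_int_add of_int_mult)

lemma split_element_empty: "split_element {#} = 1"
  by (rule poly_mapping_eqI)
     (simp add: split_element_def split_poly_def lookup_map_zero lookup_one when_def)

lemma split_element_tree:
  "split_element {#\<tau>#} = - (\<Sum>p\<in>{p \<in> Cuts {#\<tau>#}. snd p \<noteq> {#\<tau>#}}.
     real (cut_mult {#\<tau>#} p) *\<^sub>R (basis (fst p) * split_element (snd p)))"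
proof -
  have summand: "Poly_Mapping.map real_of_int (Poly_Mapping.single a (int n) * q) =
      real n *\<^sub>R (basis a * Poly_Mapping.map real_of_int q)" for a :: "'a forest" and n q
  proof -
    have "Poly_Mapping.map real_of_int (Poly_Mapping.single a (int n)) = real n *\<^sub>R basis a"
      by (rule poly_mapping_eqI) (simp add: lookup_map_zero lookup_scaleR lookup_single when_def)
    thus ?thesis
      by (simp add: map_mult_hom linear_scale[OF linear_mult_left])
  qed
  show ?thesis
    unfolding split_element_def summand[symmetric] split_poly_tree[of \<tau>]
    by (rule poly_mapping_eqI) (simp add: lookup_map_zero lookup_sum)
qed

text \<open>On a tree \<open>\<tau>\<close>, subtract \<open>counit \<star> split_element = split_element\<close> from the left-hand side. The
  trivial cut \<open>({#}, \<tau>)\<close> contributes nothing to the difference, and the counit vanishes on the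
  branches of every other cut; what remains is the sum in the recursion for the split coefficients,
  that is, minus \<open>split_element \<tau>\<close>.\<close>
lemma convolution_basis_split: "basis \<star> split_element = counit"
proof
  fix \<zeta> :: "'a forest"
  have tree: "(basis \<star> split_element) {#\<tau>#} = 0" for \<tau> :: "'a tree"
  proof -
    let ?c = "\<lambda>p. real (cut_mult {#\<tau>#} p)"
    have "(basis \<star> split_element) {#\<tau>#} - (counit \<star> split_element) {#\<tau>#} =
        (\<Sum>p\<in>Cuts {#\<tau>#}. ?c p *\<^sub>R ((basis (fst p) - counit (fst p)) * split_element (snd p)))"
      by (simp add: convolution_def lin_ext_coproduct case_prod_unfold left_diff_distrib
          scaleR_diff_right sum_subtractf)
    also have "\<dots> = (\<Sum>p\<in>{p \<in> Cuts {#\<tau>#}. snd p \<noteq> {#\<tau>#}}.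
        ?c p *\<^sub>R (basis (fst p) * split_element (snd p)))"
    proof (rule sum.mono_neutral_cong_right[OF finite_Cuts])
      have triv: "fst p = {#} \<longleftrightarrow> snd p = {#\<tau>#}" if "p \<in> Cuts {#\<tau>#}" for p
        using Cuts_trivial[of "fst p" "snd p"] that by simp
      show "\<forall>p\<in>Cuts {#\<tau>#} - {p \<in> Cuts {#\<tau>#}. snd p \<noteq> {#\<tau>#}}.
          ?c p *\<^sub>R ((basis (fst p) - counit (fst p)) * split_element (snd p)) = 0"
      proof
        fix p assume "p \<in> Cuts {#\<tau>#} - {p \<in> Cuts {#\<tau>#}. snd p \<noteq> {#\<tau>#}}"
        hence "fst p = {#}" using triv[of p] by blast
        thus "?c p *\<^sub>R ((basis (fst p) - counit (fst p)) * split_element (snd p)) = 0"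
          by (simp add: counit_def)
      qed
      show "?c p *\<^sub>R ((basis (fst p) - counit (fst p)) * split_element (snd p)) =
          ?c p *\<^sub>R (basis (fst p) * split_element (snd p))"
        if "p \<in> {p \<in> Cuts {#\<tau>#}. snd p \<noteq> {#\<tau>#}}" for p
        using triv[of p] that by (simp add: counit_def)
    qed blast
    also have "\<dots> = - split_element {#\<tau>#}"
      by (simp add: split_element_tree)
    finally show ?thesis
      by (simp add: convolution_counit_left)
  qed
  show "(basis \<star> split_element) \<zeta> = counit \<zeta>"
  proof (cases \<zeta>)
    case empty
    thus ?thesis
      by (simp add: convolution_empty split_element_empty counit_def)
  next
    case (add \<tau> \<xi>)
    have "(basis \<star> split_element) ({#\<tau>#} + \<xi>) = 0"
      by (simp only: convolution_add[OF basis_add split_element_add] tree mult_zero_left)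
    thus ?thesis by (simp add: add counit_def)
  qed
qed

theorem antipode_basis_eq_split_element: "antipode (basis \<zeta>) = split_element \<zeta>"
proof -
  let ?S = "\<lambda>\<zeta> :: 'a forest. antipode (basis \<zeta>)"
  have "?S = ?S \<star> (basis \<star> split_element)"
    by (simp only: convolution_basis_split convolution_counit_right)
  also have "\<dots> = ?S \<star> basis \<star> split_element"
    by (simp only: convolution_assoc)
  also have "\<dots> = split_element"
    by (simp only: convolution_antipode_basis convolution_counit_left)
  finally show ?thesis by (rule fun_cong)
qed

lemma split_coeff_eq: "split_coeff = (\<lambda>\<zeta>. Poly_Mapping.lookup (split_poly \<zeta>))"
  by (rule is_split_coeff_unique[OF is_split_coeff_split_coeff is_split_coeff_split_poly])

theorem theorem3p52:
  fixes \<zeta> :: "'i forest"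
  shows "finite (Splits \<zeta>) \<and>
    antipode (basis \<zeta>) = (\<Sum>S\<in>Splits \<zeta>. real_of_int (split_coeff \<zeta> S) *\<^sub>R basis S)"
proof
  show "finite (Splits \<zeta>)" by (rule finite_Splits)
  have "Poly_Mapping.keys (split_element \<zeta>) \<subseteq> Splits \<zeta>"
    using keys_split_poly[of \<zeta>] by (auto simp: split_element_def in_keys_iff lookup_map_zero)
  hence "split_element \<zeta> =
      (\<Sum>S\<in>Splits \<zeta>. Poly_Mapping.single S (Poly_Mapping.lookup (split_element \<zeta>) S))"
    by (rule poly_expand[OF finite_Splits])
  also have "\<dots> = (\<Sum>S\<in>Splits \<zeta>. real_of_int (split_coeff \<zeta> S) *\<^sub>R basis S)"
    by (intro sum.cong refl poly_mapping_eqI)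
       (simp add: split_element_def split_coeff_eq lookup_map_zero lookup_scaleR lookup_single when_def)
  finally show "antipode (basis \<zeta>) = \<dots>"
    by (simp only: antipode_basis_eq_split_element)
qed

end
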